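(* Let $n\ge 1$ be an integer, let $a_0,a_1,\ldots,a_{n-1}$ be independent standard normal $N(0,1)$ random variables, and let $$P(z)=z^n+a_{n-1}z^{n-1}+\cdots+a_1z+a_0$$ be the corresponding random monic polynomial of degree $n$. Let $p\in[0,1)$ and let $c>1$ be a real number such that $$c>\sqrt{2}\,\operatorname{erf}^{-1}\!\left(p^{1/n}\right)+1 .$$ Then $c$ is a probabilistic bound for the roots of $P(z)$ with probability at least $p$, that is, $$\mathbb{P}\bigl(\text{all complex roots of } P \text{ lie in the disc } |z|\le c\bigr)\ge p .$$
   Context: The error function is $\operatorname{erf}(x)=\frac{2}{\sqrt{\pi}}\int_0^x e^{-t^2}\,dt$, and $\operatorname{erf}^{-1}:(-1,1)\to\mathbb{R}$ is its inverse. A positive number $c$ is called a probabilistic bound for the roots of a random polynomial with probability at least $p$ if, with probability at least $p$, all complex roots of the polynomial lie in the closed disc $\{z\in\mathbb{C}:|z|\le c\}$. The probability is taken with respect to the law of the random coefficients. *)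

theory Defs
  imports "HOL-Probability.Probability" "HOL-Computational_Algebra.Polynomial"
begin

text \<open>
  The oriented interval integral is used so that the formula is also the right one for negative
  arguments.
\<close>
definition erf :: "real \<Rightarrow> real" where
  "erf x = 2 / sqrt pi * (LBINT t=ereal 0..ereal x. exp (- t\<^sup>2))"

text \<open>Only meaningful for arguments strictly between \<open>-1\<close> and \<open>1\<close>, the range of \<^const>\<open>erf\<close>.\<close>
definition erf_inv :: "real \<Rightarrow> real" where
  "erf_inv = inv erf"

definition monic_poly_of :: "nat \<Rightarrow> (nat \<Rightarrow> real) \<Rightarrow> complex poly" where
  "monic_poly_of n a = monom 1 n + (\<Sum>i<n. monom (complex_of_real (a i)) i)"

text \<open>
  A random polynomial is a polynomial-valued function on the sample space. Membership in
  \<^term>\<open>sets M\<close> is required explicitly because \<^const>\<open>measure\<close> is \<open>0\<close> outside \<^term>\<open>sets M\<close>.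
\<close>
definition probabilistic_root_bound ::
    "'w measure \<Rightarrow> ('w \<Rightarrow> complex poly) \<Rightarrow> real \<Rightarrow> real \<Rightarrow> bool" where
  "probabilistic_root_bound M P p c \<longleftrightarrow>
     0 < c \<and>
     {\<omega> \<in> space M. \<forall>z. poly (P \<omega>) z = 0 \<longrightarrow> cmod z \<le> c} \<in> sets M \<and>
     measure M {\<omega> \<in> space M. \<forall>z. poly (P \<omega>) z = 0 \<longrightarrow> cmod z \<le> c} \<ge> p"

end

theory Submission
  imports Defs
begin

text \<open>
  Put \<open>t = c - 1\<close>. By Cauchy's bound (\<open>cauchy_root_bound\<close>), a monic polynomial whose lower
  coefficients have absolute value at most \<open>t\<close> has all its roots in the disc of radius
  \<open>1 + t = c\<close>. A standard normal variable lies in the interval from \<open>-t\<close> to \<open>t\<close> with probability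
  \<open>erf (t / sqrt 2)\<close> (\<open>measure_std_normal_Icc\<close>), so by independence all \<open>n\<close> coefficients do so with
  probability \<open>erf (t / sqrt 2) ^ n\<close>. The hypothesis on \<open>c\<close> says that \<open>t / sqrt 2\<close> exceeds
  \<open>erf_inv (root n p)\<close>. As \<^const>\<open>erf\<close> is increasing, this makes the probability at least \<open>p\<close>,
  provided that \<open>erf_inv (root n p)\<close> really is a preimage of \<open>root n p\<close>: the intermediate value
  theorem gives this (\<open>erf_attains\<close>), because \<^const>\<open>erf\<close> vanishes at \<open>0\<close> and tends to \<open>1\<close>.

  It remains to see that the event about the roots is measurable, although it quantifies over all
  complex numbers. A continuous function has a zero on a compact set exactly if it takes arbitrarily
  small values on a dense subset (\<open>compact_zero_iff_dense\<close>). With countable dense subsets this makes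
  the event a countable combination of measurable ones (\<open>sets_monic_roots_in_disc\<close>).
\<close>

section \<open>The error function\<close>

lemma erf_has_real_derivative:
  "(erf has_real_derivative 2 / sqrt pi * exp (- x\<^sup>2)) (at x)"
proof -
  \<comment> \<open>Both the base point \<open>0\<close> and \<open>x\<close> have to lie in the interval, and \<open>x\<close> in its interior, for the
    fundamental theorem to give a two-sided derivative.\<close>
  define a b where "a = min 0 x - 1" and "b = max 0 x + 1"
  have "((\<lambda>u. LBINT t=ereal 0..ereal u. exp (- t\<^sup>2)) has_vector_derivative exp (- x\<^sup>2)) (at x within {a..b})"
    by (rule interval_integral_FTC2) (auto simp: a_def b_def intro!: continuous_intros)
  moreover have "at x within {a..b} = at x"
    by (rule at_within_Icc_at) (auto simp: a_def b_def)
  ultimately have "((\<lambda>u. LBINT t=ereal 0..ereal u. exp (- t\<^sup>2)) has_real_derivative exp (- x\<^sup>2)) (at x)"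
    by (simp add: has_real_derivative_iff_has_vector_derivative)
  from DERIV_cmult[OF this, of "2 / sqrt pi"] show ?thesis
    by (simp add: erf_def[abs_def])
qed

lemma isCont_erf: "isCont erf x"
  by (rule DERIV_isCont[OF erf_has_real_derivative])

lemma strict_mono_erf: "strict_mono erf"
proof (rule strict_monoI)
  fix x y :: real assume "x < y"
  then show "erf x < erf y"
  proof (rule DERIV_pos_imp_increasing)
    fix u
    have "0 < 2 / sqrt pi * exp (- u\<^sup>2)" by simp
    with erf_has_real_derivative[of u] show "\<exists>y. DERIV erf u :> y \<and> 0 < y" by blast
  qed
qed

lemma erf_0 [simp]: "erf 0 = 0"
  by (simp add: erf_def)

text \<open>The sum \<open>erf x + erf (- x)\<close> has derivative zero and vanishes at \<open>0\<close>.\<close>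
lemma erf_minus: "erf (- x) = - erf x"
proof -
  have "((\<lambda>x. erf x + erf (- x)) has_real_derivative 0) (at y)" for y
  proof -
    have "((\<lambda>x. erf (- x)) has_real_derivative 2 / sqrt pi * exp (- (- y)\<^sup>2) * (- 1)) (at y)"
      by (rule DERIV_chain2[OF erf_has_real_derivative]) (auto intro!: derivative_eq_intros)
    from DERIV_add[OF erf_has_real_derivative this] show ?thesis by simp
  qed
  then have "erf x + erf (- x) = erf 0 + erf (- 0)"
    by (intro DERIV_isconst_all[where f = "\<lambda>x. erf x + erf (- x)"] allI)
  then show ?thesis by simp
qed

text \<open>
  The substitution between the two Gaussian integrals is done by antiderivatives: the function
  \<open>erf (x / sqrt 2) / 2\<close> has derivative \<^const>\<open>std_normal_density\<close>.
\<close>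
lemma measure_std_normal_Icc:
  assumes "0 \<le> t"
  shows "measure (density lborel std_normal_density) {-t..t} = erf (t / sqrt 2)"
proof -
  define F where "F x = erf (x / sqrt 2) / 2" for x
  have F: "(F has_real_derivative std_normal_density x) (at x)" for x
  proof -
    have "((\<lambda>x. erf (x / sqrt 2)) has_real_derivative
        2 / sqrt pi * exp (- (x / sqrt 2)\<^sup>2) * (1 / sqrt 2)) (at x)"
      by (intro DERIV_chain2[OF erf_has_real_derivative] DERIV_cdivide DERIV_ident)
    from DERIV_cdivide[OF this, of 2] show ?thesis
      by (simp add: F_def[abs_def] std_normal_density_def power_divide real_sqrt_mult field_simps)
  qed
  have *: "integral\<^sup>L lborel (\<lambda>x. std_normal_density x * indicator {-t..t} x) = F t - F (-t)"
    by (rule integral_FTC_Icc_nonneg) (use assms F in simp_all)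
  have "measure (density lborel std_normal_density) {-t..t}
      = integral\<^sup>L (density lborel std_normal_density) (indicator {-t..t})"
    by simp
  also have "\<dots>
      = integral\<^sup>L lborel (\<lambda>x. std_normal_density x * indicator {-t..t} x)"
    by (subst integral_real_density) simp_all
  also have "\<dots> = erf (t / sqrt 2)"
    unfolding * by (simp add: F_def erf_minus)
  finally show ?thesis .
qed

text \<open>
  That \<^const>\<open>erf\<close> comes arbitrarily close to \<open>1\<close> is the statement that the normal distribution has
  total mass \<open>1\<close>, read through its interpretation as the mass of a symmetric interval.
\<close>
lemma erf_attains:
  assumes "0 \<le> q" "q < 1"
  shows "q \<in> range erf"
proof -
  let ?N = "density lborel std_normal_density"
  interpret N: prob_space ?N by (rule prob_space_normal_density) simp
  have "(\<Union>k. {- real k..real k}) = UNIV"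
  proof (intro equalityI subsetI UNIV_I)
    fix x :: real
    obtain k :: nat where "\<bar>x\<bar> \<le> real k" using real_arch_simple by blast
    then show "x \<in> (\<Union>k. {- real k..real k})" by (auto simp: abs_le_iff intro!: exI[of _ k])
  qed
  moreover have "(\<lambda>k. measure ?N {- real k..real k}) \<longlonglongrightarrow> measure ?N (\<Union>k. {- real k..real k})"
    by (rule N.finite_Lim_measure_incseq) (auto simp: incseq_def)
  ultimately have "(\<lambda>k. erf (real k / sqrt 2)) \<longlonglongrightarrow> 1"
    using N.prob_space by (simp add: measure_std_normal_Icc)
  then have "\<forall>\<^sub>F k in sequentially. q < erf (real k / sqrt 2)"
    using assms(2) by (rule order_tendstoD(1))
  then obtain k where k: "q < erf (real k / sqrt 2)"
    by (rule eventually_happens'[OF sequentially_bot, THEN exE])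
  have "\<exists>x\<ge>0. x \<le> real k / sqrt 2 \<and> erf x = q"
  proof (rule IVT)
    show "erf 0 \<le> q" "q \<le> erf (real k / sqrt 2)" "0 \<le> real k / sqrt 2" using assms k by simp_all
  qed (simp add: isCont_erf)
  then show ?thesis by auto
qed

section \<open>Zeros detected on a dense set\<close>

text \<open>
  Compactness turns small values into an attained minimum, which then has to be a zero.
\<close>
lemma compact_zero_iff_dense:
  fixes f :: "'a::metric_space \<Rightarrow> 'b::real_normed_vector"
  assumes "compact K" "D \<subseteq> K" "K \<subseteq> closure D" and cont: "\<And>x. isCont f x"
  shows "(\<exists>x\<in>K. f x = 0) \<longleftrightarrow> (\<forall>m. \<exists>x\<in>D. norm (f x) < 1 / real (Suc m))"
proof
  assume "\<exists>x\<in>K. f x = 0"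
  then obtain x where x: "x \<in> closure D" "f x = 0" using assms(3) by blast
  show "\<forall>m. \<exists>x\<in>D. norm (f x) < 1 / real (Suc m)"
  proof
    fix m
    have "0 < 1 / real (Suc m)" by simp
    then obtain d where d: "d > 0" "\<And>y. dist y x < d \<Longrightarrow> dist (f y) (f x) < 1 / real (Suc m)"
      using cont[of x] unfolding continuous_at_eps_delta by blast
    from x(1) d(1) obtain y where "y \<in> D" "dist y x < d"
      by (auto simp: closure_approachable)
    with d(2)[of y] x(2) show "\<exists>x\<in>D. norm (f x) < 1 / real (Suc m)"
      by (auto simp: dist_norm)
  qed
next
  assume small: "\<forall>m. \<exists>x\<in>D. norm (f x) < 1 / real (Suc m)"
  then have "K \<noteq> {}" using assms(2) by blast
  moreover have "continuous_on K (\<lambda>x. norm (f x))"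
    using cont by (intro continuous_on_norm) (simp add: continuous_at_imp_continuous_on)
  ultimately obtain x where x: "x \<in> K" "\<And>y. y \<in> K \<Longrightarrow> norm (f x) \<le> norm (f y)"
    using continuous_attains_inf[OF assms(1)] by metis
  have "f x = 0"
  proof (rule ccontr)
    assume "f x \<noteq> 0"
    then obtain m where m: "1 / real (Suc m) < norm (f x)"
      using nat_approx_posE[of "norm (f x)"] by auto
    obtain y where y: "y \<in> D" "norm (f y) < 1 / real (Suc m)" using small by blast
    then have "norm (f x) \<le> norm (f y)" using x(2) assms(2) by blast
    with y m show False by linarith
  qed
  with x(1) show "\<exists>x\<in>K. f x = 0" by blast
qed

section \<open>Roots of monic polynomials\<close>

lemma poly_monic_poly_of:
  "poly (monic_poly_of n a) z = z ^ n + (\<Sum>i<n. complex_of_real (a i) * z ^ i)"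
  by (simp add: monic_poly_of_def poly_sum poly_monom)

text \<open>
  Cauchy's bound: for \<open>z\<close> outside the disc every lower coefficient has absolute value at most
  \<open>cmod z - 1\<close>, so the lower order terms are dominated by a multiple of a geometric sum that
  telescopes to \<open>cmod z ^ n - 1\<close>, and they cannot cancel the leading term.
\<close>
lemma cauchy_root_bound:
  assumes "\<And>i. i < n \<Longrightarrow> \<bar>a i\<bar> \<le> t" "poly (monic_poly_of n a) z = 0"
  shows "cmod z \<le> 1 + t"
proof (rule ccontr)
  assume "\<not> ?thesis"
  then have z: "t \<le> cmod z - 1" by simp
  have "z ^ n = - (\<Sum>i<n. complex_of_real (a i) * z ^ i)"
    using assms(2) by (simp add: poly_monic_poly_of eq_neg_iff_add_eq_0)
  then have "cmod z ^ n = cmod (\<Sum>i<n. complex_of_real (a i) * z ^ i)"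
    by (metis norm_minus_cancel norm_power)
  also have "\<dots> \<le> (\<Sum>i<n. \<bar>a i\<bar> * cmod z ^ i)"
    by (rule order_trans[OF norm_sum]) (simp add: norm_mult norm_power)
  also have "\<dots> \<le> (\<Sum>i<n. (cmod z - 1) * cmod z ^ i)"
    using assms(1) z by (intro sum_mono mult_right_mono) (auto intro: order_trans)
  also have "\<dots> = cmod z ^ n - 1"
    by (simp add: power_diff_1_eq sum_distrib_left)
  finally show False by simp
qed

text \<open>
  A root outside the disc is an existential statement over uncountably many points. Writing the
  outside as a countable union of compact annuli and replacing each annulus by a countable dense
  subset leaves only countably many conditions on values of the polynomial at fixed points.
\<close>
lemma sets_monic_roots_in_disc:
  assumes "\<And>i. i < n \<Longrightarrow> a i \<in> borel_measurable M"
  shows "{\<omega> \<in> space M. \<forall>z. poly (monic_poly_of n (\<lambda>i. a i \<omega>)) z = 0 \<longrightarrow> cmod z \<le> c} \<in> sets M"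
proof -
  define P where "P \<omega> = poly (monic_poly_of n (\<lambda>i. a i \<omega>))" for \<omega>
  have "(\<lambda>\<omega>. complex_of_real (a i \<omega>)) \<in> borel_measurable M" if "i < n" for i
    by (rule measurable_compose[OF assms[OF that] borel_measurable_of_real])
  then have P_meas: "(\<lambda>\<omega>. P \<omega> z) \<in> borel_measurable M" for z
    unfolding P_def poly_monic_poly_of
    by (intro borel_measurable_add borel_measurable_sum borel_measurable_times
        borel_measurable_const) simp
  \<comment> \<open>Closed annuli that exhaust the open set \<open>cmod z > c\<close>.\<close>
  define K where "K k = {z. c + 1 / real (Suc k) \<le> cmod z \<and> cmod z \<le> real k}" for k :: nat
  have "closed (K k)" for k
    unfolding K_def by (intro closed_Collect_conj closed_Collect_le continuous_intros)
  moreover have "bounded (K k)" for k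
    unfolding K_def by (rule boundedI[of _ "real k"]) simp
  ultimately have compact_K: "compact (K k)" for k
    by (simp add: compact_eq_bounded_closed)
  have "\<forall>k. \<exists>D. countable D \<and> D \<subseteq> K k \<and> K k \<subseteq> closure D"
    using separable by metis
  then obtain D where D: "\<And>k. countable (D k)" "\<And>k. D k \<subseteq> K k" "\<And>k. K k \<subseteq> closure (D k)"
    by metis
  have root_iff: "(\<exists>z\<in>K k. P \<omega> z = 0) \<longleftrightarrow> (\<forall>m. \<exists>z\<in>D k. cmod (P \<omega> z) < 1 / real (Suc m))" for k \<omega>
    by (rule compact_zero_iff_dense[OF compact_K D(2,3)]) (simp add: P_def)
  have outside: "(\<exists>k. z \<in> K k) \<longleftrightarrow> c < cmod z" for z
  proof
    assume "\<exists>k. z \<in> K k"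
    then obtain k where "c + 1 / real (Suc k) \<le> cmod z" by (auto simp: K_def)
    moreover have "0 < 1 / real (Suc k)" by simp
    ultimately show "c < cmod z" by linarith
  next
    assume "c < cmod z"
    then obtain m where m: "1 / real (Suc m) < cmod z - c"
      using nat_approx_posE[of "cmod z - c"] by auto
    obtain l :: nat where l: "cmod z \<le> real l" using real_arch_simple by blast
    have "1 / real (Suc (max m l)) \<le> 1 / real (Suc m)"
      by (intro divide_left_mono) auto
    with m l have "z \<in> K (max m l)" unfolding K_def mem_Collect_eq by (intro conjI) linarith+
    then show "\<exists>k. z \<in> K k" ..
  qed
  have "{\<omega> \<in> space M. \<forall>z. P \<omega> z = 0 \<longrightarrow> cmod z \<le> c}
      = {\<omega> \<in> space M. \<forall>k. \<not> (\<exists>z\<in>K k. P \<omega> z = 0)}"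
    using outside by (auto simp: not_less[symmetric])
  also have "\<dots> = {\<omega> \<in> space M. \<forall>k. \<not> (\<forall>m. \<exists>z\<in>D k. cmod (P \<omega> z) < 1 / real (Suc m))}"
    unfolding root_iff ..
  also have "\<dots> \<in> sets M"
  proof -
    have "{\<omega> \<in> space M. cmod (P \<omega> z) < 1 / real (Suc m)} \<in> sets M" for z m
      using P_meas[of z] by measurable
    then show ?thesis
      by (intro sets.sets_Collect_countable_All sets.sets_Collect_neg
          sets.sets_Collect_countable_Ex' D(1))
  qed
  finally show ?thesis unfolding P_def .
qed

section \<open>The probabilistic bound\<close>

theorem theorem1:
  fixes M :: "'w measure" and a :: "nat \<Rightarrow> 'w \<Rightarrow> real" and n :: nat and p c :: real
  assumes "prob_space M"
    and "n \<ge> 1"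
    and "prob_space.indep_vars M (\<lambda>_. borel) a {..<n}"
    and "\<And>i. i < n \<Longrightarrow> distributed M lborel (a i) std_normal_density"
    and "0 \<le> p" and "p < 1"
    and "c > 1"
    and "c > sqrt 2 * erf_inv (root n p) + 1"
  shows "probabilistic_root_bound M (\<lambda>\<omega>. monic_poly_of n (\<lambda>i. a i \<omega>)) p c"
proof -
  interpret prob_space M by fact
  define t where "t = c - 1"
  have t: "0 < t" "c = 1 + t" using assms(7) by (auto simp: t_def)
  define q where "q = root n p"
  have n: "0 < n" using assms(2) by simp
  have q: "0 \<le> q" "q < 1" using assms(5,6) n by (auto simp: q_def)
  have "erf (erf_inv q) = q"
    unfolding erf_inv_def by (rule f_inv_into_f[OF erf_attains[OF q]])
  moreover have "erf_inv q < t / sqrt 2"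
    using assms(8) by (simp add: t_def q_def field_simps)
  ultimately have q_less: "q \<le> erf (t / sqrt 2)"
    using strict_monoD[OF strict_mono_erf] by (metis less_imp_le)
  have meas: "a i \<in> borel_measurable M" if "i < n" for i
    using distributed_measurable[OF assms(4)[OF that]] by simp
  define A where "A i = a i -` {-t..t} \<inter> space M" for i
  have prob_A: "prob (A i) = erf (t / sqrt 2)" if "i < n" for i
  proof -
    have "prob (A i) = measure (distr M lborel (a i)) {-t..t}"
      using meas[OF that] by (simp add: measure_distr A_def)
    also have "\<dots> = erf (t / sqrt 2)"
      using distributed_distr_eq_density[OF assms(4)[OF that]] measure_std_normal_Icc t by simp
    finally show ?thesis .
  qed
  have A_sets: "A i \<in> sets M" if "i < n" for i
    using meas[OF that] unfolding A_def by measurable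
  have "p = q ^ n" using assms(5) n by (simp add: q_def)
  also have "\<dots> \<le> erf (t / sqrt 2) ^ n" using q_less q by (intro power_mono)
  also have "\<dots> = (\<Prod>i<n. prob (A i))" by (simp add: prob_A)
  also have "\<dots> = prob (\<Inter>i<n. A i)"
    unfolding A_def using assms(3) n by (intro indep_varsD[symmetric]) auto
  also have "\<dots> \<le> prob {\<omega> \<in> space M. \<forall>z. poly (monic_poly_of n (\<lambda>i. a i \<omega>)) z = 0 \<longrightarrow> cmod z \<le> c}"
  proof (rule finite_measure_mono[OF _ sets_monic_roots_in_disc[OF meas]])
    have "cmod z \<le> c" if "\<forall>i<n. \<bar>a i \<omega>\<bar> \<le> t" "poly (monic_poly_of n (\<lambda>i. a i \<omega>)) z = 0" for \<omega> z
      using cauchy_root_bound[of n "\<lambda>i. a i \<omega>" t z] that t by simp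
    then show "(\<Inter>i<n. A i) \<subseteq> {\<omega> \<in> space M. \<forall>z. poly (monic_poly_of n (\<lambda>i. a i \<omega>)) z = 0 \<longrightarrow> cmod z \<le> c}"
      using n by (fastforce simp: A_def abs_le_iff)
  qed
  finally show ?thesis
    unfolding probabilistic_root_bound_def
    using sets_monic_roots_in_disc[OF meas] assms(7) by simp
qed

end
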